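(* Let $A(t),B(t)\in\mathbb{R}[\cos(t),\sin(t)]$. The equation $x'=A(t)x^3+B(t)x^2$ has two different non-trivial invariant curves if and only if there exist $G(t),\hat G(t),S_1(t)\in\mathbb{R}[\cos(t),\sin(t)]$, with $\hat G$ not identically zero, and $k\in\mathbb{R}\setminus\{0\}$ such that $G(t)\neq0$, $S_1(t)\neq0$ and $S_1(t)+k\hat G(t)\neq0$ for all $t\in\mathbb{R}$, every irreducible factor of $\hat G(t)$ divides $G(t)$, and \[A(t)=G(t)S_1(t)\bigl(S_1(t)+k\hat G(t)\bigr)\left(G'(t)+\frac{G(t)\hat G'(t)}{\hat G(t)}\right),\] \[B(t)=-\bigl(G(t)S_1(t)\bigr)'-\bigl(S_1(t)+k\hat G(t)\bigr)\left(G'(t)+\frac{G(t)\hat G'(t)}{\hat G(t)}\right).\] Furthermore, in this case the two different invariant curves are \[1-G(t)S_1(t)x=0\quad\text{and}\quad 1-G(t)\bigl(S_1(t)+k\hat G(t)\bigr)x=0.\]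
   Context: $\mathbb{R}[\cos(t),\sin(t)]$ is the ring of real trigonometric polynomials; its units are the non-zero constants, and every non-zero non-unit is a finite product of irreducible elements. For the equation $x'=A(t)x^3+B(t)x^2$ put $\mathcal{X}=\frac{\partial}{\partial t}+(A(t)x^3+B(t)x^2)\frac{\partial}{\partial x}$. An invariant curve of the equation here means a curve $f(t,x)=0$ with $f(t,x)=Q(t)-P(t)x$, where $P,Q\in\mathbb{R}[\cos(t),\sin(t)]$, $P(t)\neq0$ for all $t\in\mathbb{R}$, $Q(t)-P(t)x$ is irreducible in $\mathbb{R}[\cos(t),\sin(t)][x]$ (i.e. $P$ and $Q$ have no common non-unit factor), and there is a continuous function $K(t,x)$ on $\mathbb{R}^2$ with $\mathcal{X}f=Kf$. It is non-trivial if $Q\neq0$, i.e. if it is not the curve $x=0$. *)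

theory Defs
  imports "HOL-Analysis.Analysis" "HOL-Computational_Algebra.Computational_Algebra"
begin

inductive_set trig_fun :: "(real \<Rightarrow> real) set" where
  const: "(\<lambda>_. c) \<in> trig_fun"
| cos: "cos \<in> trig_fun"
| sin: "sin \<in> trig_fun"
| add: "f \<in> trig_fun \<Longrightarrow> g \<in> trig_fun \<Longrightarrow> (\<lambda>t. f t + g t) \<in> trig_fun"
| mult: "f \<in> trig_fun \<Longrightarrow> g \<in> trig_fun \<Longrightarrow> (\<lambda>t. f t * g t) \<in> trig_fun"

lemma trig_fun_uminus: "f \<in> trig_fun \<Longrightarrow> (\<lambda>t. - f t) \<in> trig_fun"
  using trig_fun.mult[OF trig_fun.const[of "-1"], of f] by simp

lemma trig_fun_diff: "f \<in> trig_fun \<Longrightarrow> g \<in> trig_fun \<Longrightarrow> (\<lambda>t. f t - g t) \<in> trig_fun"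
  using trig_fun.add[OF _ trig_fun_uminus, of f g] by simp

typedef trig_poly = trig_fun
  morphisms tp_eval Abs_trig_poly
  using trig_fun.cos by blast

setup_lifting type_definition_trig_poly

instantiation trig_poly :: "{comm_ring_1, real_algebra_1}"
begin

lift_definition zero_trig_poly :: trig_poly is "\<lambda>_. 0" by (rule trig_fun.const)
lift_definition one_trig_poly :: trig_poly is "\<lambda>_. 1" by (rule trig_fun.const)
lift_definition plus_trig_poly :: "trig_poly \<Rightarrow> trig_poly \<Rightarrow> trig_poly"
  is "\<lambda>f g t. f t + g t" by (rule trig_fun.add)
lift_definition times_trig_poly :: "trig_poly \<Rightarrow> trig_poly \<Rightarrow> trig_poly"
  is "\<lambda>f g t. f t * g t" by (rule trig_fun.mult)
lift_definition minus_trig_poly :: "trig_poly \<Rightarrow> trig_poly \<Rightarrow> trig_poly"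
  is "\<lambda>f g t. f t - g t" by (rule trig_fun_diff)
lift_definition uminus_trig_poly :: "trig_poly \<Rightarrow> trig_poly"
  is "\<lambda>f t. - f t" by (rule trig_fun_uminus)
lift_definition scaleR_trig_poly :: "real \<Rightarrow> trig_poly \<Rightarrow> trig_poly"
  is "\<lambda>k f t. k * f t" by (rule trig_fun.mult[OF trig_fun.const])

instance
  by standard (transfer; simp add: fun_eq_iff algebra_simps)+

end

lemma tp_eval_simps [simp]:
  "tp_eval 0 t = 0" "tp_eval 1 t = 1"
  "tp_eval (f + g) t = tp_eval f t + tp_eval g t"
  "tp_eval (f - g) t = tp_eval f t - tp_eval g t"
  "tp_eval (f * g) t = tp_eval f t * tp_eval g t"
  "tp_eval (- f) t = - tp_eval f t"
  "tp_eval (k *\<^sub>R f) t = k * tp_eval f t"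
  by (transfer; simp)+

lemma trig_poly_eqI: "(\<And>t. tp_eval f t = tp_eval g t) \<Longrightarrow> f = g"
  by transfer (simp add: fun_eq_iff)

lemma tp_eval_differentiable: "tp_eval f field_differentiable at t"
proof -
  have "g field_differentiable at t" if "g \<in> trig_fun" for g
    using that
    by (induction rule: trig_fun.induct)
      (auto intro: field_differentiable_add field_differentiable_mult
        field_differentiable_within_sin field_differentiable_within_cos)
  then show ?thesis
    using tp_eval by blast
qed

definition line_fun :: "trig_poly \<Rightarrow> trig_poly \<Rightarrow> real \<Rightarrow> real \<Rightarrow> real" where
  "line_fun P Q t x = tp_eval Q t - tp_eval P t * x"

definition curve :: "trig_poly \<Rightarrow> trig_poly \<Rightarrow> (real \<times> real) set" where
  "curve P Q = {(t, x). line_fun P Q t x = 0}"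

definition abel_field ::
  "trig_poly \<Rightarrow> trig_poly \<Rightarrow> (real \<Rightarrow> real \<Rightarrow> real) \<Rightarrow> real \<Rightarrow> real \<Rightarrow> real" where
  "abel_field A B f t x =
     deriv (\<lambda>s. f s x) t
     + (tp_eval A t * x ^ 3 + tp_eval B t * x ^ 2) * deriv (\<lambda>y. f t y) x"

definition invariant_curve ::
  "trig_poly \<Rightarrow> trig_poly \<Rightarrow> trig_poly \<Rightarrow> trig_poly \<Rightarrow> bool" where
  "invariant_curve A B P Q \<longleftrightarrow>
     (\<forall>t. tp_eval P t \<noteq> 0) \<and>
     irreducible [:Q, - P:] \<and>
     (\<exists>K :: real \<times> real \<Rightarrow> real. continuous_on UNIV K \<and>
        (\<forall>t x. abel_field A B (line_fun P Q) t x = K (t, x) * line_fun P Q t x))"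

definition two_different_nontrivial_curves ::
  "trig_poly \<Rightarrow> trig_poly \<Rightarrow> trig_poly \<Rightarrow> trig_poly \<Rightarrow> trig_poly \<Rightarrow> trig_poly \<Rightarrow> bool" where
  "two_different_nontrivial_curves A B P1 Q1 P2 Q2 \<longleftrightarrow>
     invariant_curve A B P1 Q1 \<and> Q1 \<noteq> 0 \<and>
     invariant_curve A B P2 Q2 \<and> Q2 \<noteq> 0 \<and>
     curve P1 Q1 \<noteq> curve P2 Q2"

text \<open>
  The quotient by \<open>Gh t\<close> below is never a division by zero: \<open>Gh\<close> is a non-zero product of
  irreducible elements (up to a constant), each of which divides the nowhere vanishing \<open>G\<close>.
\<close>

definition curve_data ::
  "trig_poly \<Rightarrow> trig_poly \<Rightarrow> trig_poly \<Rightarrow> trig_poly \<Rightarrow> trig_poly \<Rightarrow> real \<Rightarrow> bool" where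
  "curve_data A B G Gh S1 k \<longleftrightarrow>
     Gh \<noteq> 0 \<and> k \<noteq> 0 \<and>
     (\<forall>t. tp_eval G t \<noteq> 0) \<and>
     (\<forall>t. tp_eval S1 t \<noteq> 0) \<and>
     (\<forall>t. tp_eval S1 t + k * tp_eval Gh t \<noteq> 0) \<and>
     (\<forall>q. irreducible q \<and> q dvd Gh \<longrightarrow> q dvd G) \<and>
     (\<forall>t. tp_eval A t =
        tp_eval G t * tp_eval S1 t * (tp_eval S1 t + k * tp_eval Gh t)
        * (deriv (tp_eval G) t + tp_eval G t * deriv (tp_eval Gh) t / tp_eval Gh t)) \<and>
     (\<forall>t. tp_eval B t =
        - deriv (\<lambda>s. tp_eval G s * tp_eval S1 s) t
        - (tp_eval S1 t + k * tp_eval Gh t)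
        * (deriv (tp_eval G) t + tp_eval G t * deriv (tp_eval Gh) t / tp_eval Gh t))"

end

theory Submission
  imports Defs
begin

text \<open>
  A trigonometric polynomial is the restriction to the unit circle of a Laurent polynomial, so it
  has complex zeros \<open>w \<noteq> 0\<close>; those with \<open>norm w = 1\<close> are its real zeros. The ring is not factorial,
  but a zero off the unit circle always splits off the prime \<open>lin_factor w\<close>, and an element without
  zeros is constant. Hence nowhere vanishing elements have greatest common divisors.

  If \<open>Q - P x\<close> is invariant then \<open>Q\<close> divides \<open>P\<^sup>2 Q'\<close>; as \<open>Q'/Q\<close> has a pole at each zero of \<open>Q\<close>,
  such a zero would be a zero of \<open>P\<close> too, contradicting irreducibility. So \<open>Q\<close> is a constant and
  may be taken to be 1, and invariance becomes \<open>A + B P + P P' = 0\<close>. For two curves write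
  \<open>P\<^sub>i = G S\<^sub>i\<close> with \<open>S\<^sub>1\<close>, \<open>S\<^sub>2\<close> without common zeros and put \<open>Gh = S\<^sub>2 - S\<^sub>1\<close>: subtracting the two
  equations shows that \<open>Gh\<close> divides \<open>S\<^sub>2 G Gh'\<close>, so by the same pole argument every zero of \<open>Gh\<close> is
  a zero of \<open>G\<close>.
\<close>

section \<open>Laurent representation and complex zeros\<close>

text \<open>The factor \<open>cis t ^ n\<close> clears negative powers, so that computations stay in
  \<open>complex poly\<close>. The pair \<open>(p, n)\<close> is not unique: \<open>p\<close> may be
  multiplied by the variable while \<open>n\<close> grows by one.\<close>

definition laurent_rep :: "trig_poly \<Rightarrow> complex poly \<Rightarrow> nat \<Rightarrow> bool" where
  "laurent_rep f p n \<longleftrightarrow> (\<forall>t. of_real (tp_eval f t) * cis t ^ n = poly p (cis t))"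

lemma infinite_range_cis: "infinite (range cis)"
proof
  assume fin: "finite (range cis)"
  have "{-1..1} \<subseteq> Re ` range cis"
  proof
    fix x :: real assume "x \<in> {-1..1}"
    then have "x = Re (cis (arccos x))" by simp
    then show "x \<in> Re ` range cis" by blast
  qed
  with fin have "finite {-1..1::real}"
    using finite_subset by blast
  then show False
    using infinite_Icc[of "-1" "1::real"] by simp
qed

lemma poly_eq_on_unit_circle:
  fixes p q :: "complex poly"
  assumes "\<And>t. poly p (cis t) = poly q (cis t)"
  shows "p = q"
proof (rule ccontr)
  assume "p \<noteq> q"
  then have "finite {x. poly (p - q) x = 0}"
    by (intro poly_roots_finite) simp
  moreover have "range cis \<subseteq> {x. poly (p - q) x = 0}"
    using assms by auto
  ultimately show False
    using infinite_range_cis finite_subset by blast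
qed

text \<open>Representations differ only by powers of the variable. The crosswise form makes
  \<open>cev\<close> and \<open>zero_count\<close> independent of the representation chosen.\<close>

lemma laurent_rep_unique:
  assumes "laurent_rep f p n" "laurent_rep f q m"
  shows "p * monom 1 m = q * monom 1 n"
proof (rule poly_eq_on_unit_circle)
  fix t
  have "poly p (cis t) * cis t ^ m = of_real (tp_eval f t) * cis t ^ n * cis t ^ m"
    using assms(1) by (simp add: laurent_rep_def)
  also have "\<dots> = poly q (cis t) * cis t ^ n"
    using assms(2) by (simp add: laurent_rep_def mult_ac)
  finally show "poly (p * monom 1 m) (cis t) = poly (q * monom 1 n) (cis t)"
    by (simp add: poly_monom)
qed

lemma laurent_rep_const: "laurent_rep (c *\<^sub>R 1) [:of_real c:] 0"
  by (simp add: laurent_rep_def)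

lemma laurent_rep_add:
  assumes "laurent_rep f p n" "laurent_rep g q m"
  shows "laurent_rep (f + g) (p * monom 1 m + q * monom 1 n) (n + m)"
  using assms unfolding laurent_rep_def
  by (simp add: poly_monom algebra_simps power_add)

lemma laurent_rep_mult:
  assumes "laurent_rep f p n" "laurent_rep g q m"
  shows "laurent_rep (f * g) (p * q) (n + m)"
  using assms unfolding laurent_rep_def
  by (simp add: power_add) (metis mult.assoc mult.left_commute)

lift_definition tp_cos :: trig_poly is cos by (rule trig_fun.cos)
lift_definition tp_sin :: trig_poly is sin by (rule trig_fun.sin)

lemma tp_eval_cos_sin [simp]: "tp_eval tp_cos t = cos t" "tp_eval tp_sin t = sin t"
  by (transfer; simp)+

text \<open>Euler's formula multiplied by z = \<open>cis t\<close>: z cos t = (z^2 + 1)/2. In the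
  same way z sin t = (z^2 - 1)/(2i) gives \<open>laurent_rep_sin\<close>.\<close>

lemma laurent_rep_cos: "laurent_rep tp_cos [:1/2, 0, 1/2:] 1"
  unfolding laurent_rep_def
proof
  fix t :: real
  have "cos t * cos t + sin t * sin t = 1"
    using sin_cos_squared_add3 by blast
  then show "of_real (tp_eval tp_cos t) * cis t ^ 1 = poly [:1/2, 0, 1/2:] (cis t)"
    by (simp add: complex_eq_iff field_simps)
qed

lemma laurent_rep_sin: "laurent_rep tp_sin [:\<i>/2, 0, -\<i>/2:] 1"
  unfolding laurent_rep_def
proof
  fix t :: real
  have "cos t * cos t + sin t * sin t = 1"
    using sin_cos_squared_add3 by blast
  then show "of_real (tp_eval tp_sin t) * cis t ^ 1 = poly [:\<i>/2, 0, -\<i>/2:] (cis t)"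
    by (simp add: complex_eq_iff field_simps)
qed

lemma trig_poly_induct [case_names const cos sin add mult]:
  assumes "\<And>c. P (c *\<^sub>R 1)" "P tp_cos" "P tp_sin"
    and "\<And>f g. P f \<Longrightarrow> P g \<Longrightarrow> P (f + g)"
    and "\<And>f g. P f \<Longrightarrow> P g \<Longrightarrow> P (f * g)"
  shows "P f"
proof -
  have "P (Abs_trig_poly g)" if "g \<in> trig_fun" for g
    using that
  proof (induction rule: trig_fun.induct)
    case (const c)
    have "Abs_trig_poly (\<lambda>_. c) = c *\<^sub>R 1"
      by (rule trig_poly_eqI) (simp add: Abs_trig_poly_inverse trig_fun.const)
    then show ?case using assms(1) by simp
  next
    case cos
    then show ?case using assms(2) by (simp add: tp_cos_def)
  next
    case sin
    then show ?case using assms(3) by (simp add: tp_sin_def)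
  next
    case (add f g)
    have "Abs_trig_poly (\<lambda>t. f t + g t) = Abs_trig_poly f + Abs_trig_poly g"
      by (rule trig_poly_eqI) (simp add: Abs_trig_poly_inverse trig_fun.add add)
    then show ?case using assms(4) add by simp
  next
    case (mult f g)
    have "Abs_trig_poly (\<lambda>t. f t * g t) = Abs_trig_poly f * Abs_trig_poly g"
      by (rule trig_poly_eqI) (simp add: Abs_trig_poly_inverse trig_fun.mult mult)
    then show ?case using assms(5) mult by simp
  qed
  from this[OF tp_eval[of f]] show ?thesis by (simp add: tp_eval_inverse)
qed

lemma laurent_rep_exists: "\<exists>p n. laurent_rep f p n"
  by (induction f rule: trig_poly_induct)
    (blast intro: laurent_rep_const laurent_rep_cos laurent_rep_sin
      laurent_rep_add laurent_rep_mult)+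

lemma laurent_rep_eq_0_iff: "laurent_rep f p n \<Longrightarrow> p = 0 \<longleftrightarrow> f = 0"
proof
  assume "laurent_rep f p n" "p = 0"
  then show "f = 0"
    by (intro trig_poly_eqI) (simp add: laurent_rep_def)
next
  assume "laurent_rep f p n" "f = 0"
  then show "p = 0"
    by (intro poly_eq_on_unit_circle) (auto simp: laurent_rep_def)
qed

text \<open>Non-zero elements have non-zero numerators, and a product is represented by the product
  of the numerators, which lie in an integral domain.\<close>

instance trig_poly :: idom
proof
  fix f g :: trig_poly
  assume "f \<noteq> 0" "g \<noteq> 0"
  obtain p n q m where "laurent_rep f p n" "laurent_rep g q m"
    using laurent_rep_exists by metis
  then show "f * g \<noteq> 0"
    using \<open>f \<noteq> 0\<close> \<open>g \<noteq> 0\<close> laurent_rep_mult laurent_rep_eq_0_iff by (metis mult_eq_0_iff)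
qed

text \<open>The value at \<open>w \<noteq> 0\<close> of the Laurent polynomial that agrees with \<open>f\<close> on the unit circle.\<close>

definition cev :: "complex \<Rightarrow> trig_poly \<Rightarrow> complex" where
  "cev w f = (SOME c. \<exists>p n. laurent_rep f p n \<and> c = poly p w / w ^ n)"

lemma cev_eq:
  assumes "w \<noteq> 0" "laurent_rep f p n"
  shows "cev w f = poly p w / w ^ n"
proof -
  have "\<exists>q m. laurent_rep f q m \<and> cev w f = poly q w / w ^ m"
    unfolding cev_def by (rule someI_ex) (use assms in blast)
  then obtain q m where q: "laurent_rep f q m" "cev w f = poly q w / w ^ m"
    by blast
  have "poly (p * monom 1 m) w = poly (q * monom 1 n) w"
    using laurent_rep_unique[OF assms(2) q(1)] by simp
  then show ?thesis
    using assms(1) by (simp add: q(2) poly_monom frac_eq_eq)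
qed

lemma cev_eq_0_iff: "w \<noteq> 0 \<Longrightarrow> laurent_rep f p n \<Longrightarrow> cev w f = 0 \<longleftrightarrow> poly p w = 0"
  by (simp add: cev_eq)

context
  fixes w :: complex
  assumes w: "w \<noteq> 0"
begin

lemma cev_const: "cev w (c *\<^sub>R 1) = of_real c"
  using cev_eq[OF w laurent_rep_const] by simp

lemma cev_cos: "cev w tp_cos = (w + 1 / w) / 2"
  using cev_eq[OF w laurent_rep_cos] w by (simp add: field_simps)

lemma cev_sin: "cev w tp_sin = \<i> * (1 / w - w) / 2"
  using cev_eq[OF w laurent_rep_sin] w by (simp add: field_simps)

lemma cev_add: "cev w (f + g) = cev w f + cev w g"
proof -
  obtain p n q m where "laurent_rep f p n" "laurent_rep g q m"
    using laurent_rep_exists by metis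
  from cev_eq[OF w this(1)] cev_eq[OF w this(2)] cev_eq[OF w laurent_rep_add[OF this]]
  show ?thesis using w by (simp add: poly_monom power_add add_divide_distrib)
qed

lemma cev_mult: "cev w (f * g) = cev w f * cev w g"
proof -
  obtain p n q m where "laurent_rep f p n" "laurent_rep g q m"
    using laurent_rep_exists by metis
  from cev_eq[OF w this(1)] cev_eq[OF w this(2)] cev_eq[OF w laurent_rep_mult[OF this]]
  show ?thesis using w by (simp add: power_add)
qed

lemma cev_scaleR: "cev w (c *\<^sub>R f) = of_real c * cev w f"
  using cev_mult[of "c *\<^sub>R 1" f] cev_const by simp

lemma cev_diff: "cev w (f - g) = cev w f - cev w g"
  using cev_add[of f "(-1) *\<^sub>R g"] cev_scaleR[of "-1" g] by simp

lemma cev_one: "cev w 1 = 1"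
  using cev_const[of 1] by simp

end

lemma cev_cis: "cev (cis t) f = of_real (tp_eval f t)"
proof -
  obtain p n where "laurent_rep f p n" using laurent_rep_exists by metis
  then show ?thesis
    using cev_eq[OF cis_neq_zero, of f p n t]
    by (metis laurent_rep_def cis_neq_zero nonzero_mult_div_cancel_right power_not_zero)
qed

text \<open>Points of the unit circle are real values of t. An element that vanishes for no real t
  therefore has all its zeros off the circle.\<close>

lemma cev_unit_circle:
  assumes "norm w = 1"
  obtains t where "\<And>f. cev w f = of_real (tp_eval f t)"
proof -
  from assms have "w = cis (Arg w)"
    by (metis cis_Arg norm_zero sgn_div_norm div_by_1 scaleR_one inverse_1 zero_neq_one)
  then show ?thesis using that cev_cis by metis
qed

lemma not_unit_if_cev_0: "w \<noteq> 0 \<Longrightarrow> cev w f = 0 \<Longrightarrow> \<not> f dvd 1"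
  by (auto simp: dvd_def) (metis cev_mult cev_one mult_zero_left zero_neq_one)

lemma cev_dvd_0: "w \<noteq> 0 \<Longrightarrow> f dvd g \<Longrightarrow> cev w f = 0 \<Longrightarrow> cev w g = 0"
  by (auto simp: dvd_def cev_mult)

text \<open>A numerator without zeros outside the origin is a constant times a power of the
  variable, so \<open>f\<close> has constant modulus on the circle. Being real, \<open>f\<close> has
  a constant square, and the absence of zero divisors fixes its sign.\<close>

lemma const_if_cev_nonzero:
  assumes "\<And>w. w \<noteq> 0 \<Longrightarrow> cev w f \<noteq> 0"
  obtains c where "c \<noteq> 0" "f = c *\<^sub>R 1"
proof -
  obtain p n where p: "laurent_rep f p n" using laurent_rep_exists by metis
  have nz: "poly p w \<noteq> 0" if "w \<noteq> 0" for w
    using assms[OF that] cev_eq_0_iff[OF that p] by simp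
  then have "p \<noteq> 0" using zero_neq_one by fastforce
  \<comment> \<open>All zeros of \<open>p\<close> lie at the origin; dividing them out leaves
    \<open>r\<close> without any zero.\<close>
  then obtain r where r: "p = [:- 0, 1:] ^ order 0 p * r" "\<not> [:- 0, 1:] dvd r"
    using order_decomp by blast
  have "poly r w \<noteq> 0" for w
  proof (cases "w = 0")
    case True
    then show ?thesis using r(2) by (simp add: dvd_iff_poly_eq_0)
  next
    case False
    then show ?thesis using nz[OF False] by (subst (asm) r(1)) simp
  qed
  then have "constant (poly r)"
    using fundamental_theorem_of_algebra by blast
  then have c: "poly r w = poly r 0" for w by (simp add: constant_def)
  have sq: "(tp_eval f t)\<^sup>2 = (norm (poly r 0))\<^sup>2" for t
  proof -
    have "norm (of_real (tp_eval f t) * cis t ^ n) = norm (poly p (cis t))"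
      using p by (simp add: laurent_rep_def)
    also have "\<dots> = norm (poly r 0)"
      by (subst r(1)) (simp add: norm_mult norm_power c[of "cis t"])
    finally have "\<bar>tp_eval f t\<bar> = norm (poly r 0)"
      by (simp add: norm_mult norm_power)
    then show ?thesis by (metis power2_abs)
  qed
  define a where "a = norm (poly r 0)"
  have "a \<noteq> 0" using \<open>\<And>w. poly r w \<noteq> 0\<close> by (simp add: a_def)
  have "(f - a *\<^sub>R 1) * (f + a *\<^sub>R 1) = 0"
    by (rule trig_poly_eqI) (use sq in \<open>simp add: a_def algebra_simps power2_eq_square\<close>)
  then have "f = a *\<^sub>R 1 \<or> f = (- a) *\<^sub>R 1"
    by (auto simp: eq_neg_iff_add_eq_0)
  then show ?thesis using that \<open>a \<noteq> 0\<close> by (metis neg_equal_0_iff_equal)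
qed

section \<open>The prime attached to a pair of conjugate zeros\<close>

text \<open>On the unit circle, \<open>lin_factor w\<close> is the squared distance to \<open>w\<close>.\<close>

definition lin_factor :: "complex \<Rightarrow> trig_poly" where
  "lin_factor w = (1 + (norm w)\<^sup>2) *\<^sub>R 1 - (2 * Re w) *\<^sub>R tp_cos - (2 * Im w) *\<^sub>R tp_sin"

text \<open>For z on the unit circle, |z - w|^2 = (z - w)(1/z - \<open>cnj w\<close>). If
  \<open>w \<noteq> 0\<close>, the zeros are \<open>w\<close> and its mirror image
  1/\<open>cnj w\<close>.\<close>

lemma laurent_rep_lin_factor: "laurent_rep (lin_factor w) ([:-w, 1:] * [:1, - cnj w:]) 1"
  unfolding laurent_rep_def
proof
  fix t :: real
  have "cos t * cos t + sin t * sin t = 1"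
    using sin_cos_squared_add3 by blast
  then have "cos t * cos t = 1 - sin t * sin t" by linarith
  \<comment> \<open>The same identity for products nested to the right, the shape that
    \<open>algebra_simps\<close> produces.\<close>
  then have "cos t * (cos t * x) = x - sin t * (sin t * x)" for x
    by (metis left_diff_distrib mult.assoc mult_1)
  with \<open>cos t * cos t = 1 - sin t * sin t\<close>
  show "of_real (tp_eval (lin_factor w) t) * cis t ^ 1 = poly ([:-w, 1:] * [:1, - cnj w:]) (cis t)"
    by (simp add: complex_eq_iff lin_factor_def cmod_def algebra_simps power2_eq_square)
qed

lemma cev_lin_factor: "w \<noteq> 0 \<Longrightarrow> cev w (lin_factor w) = 0"
  by (simp add: cev_eq_0_iff[OF _ laurent_rep_lin_factor])

text \<open>Modulo \<open>lin_factor w\<close> the ring is spanned over the reals by 1 and one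
  further element, which is -1/2 times the derivative of \<open>lin_factor w\<close>. The claim
  holds for cosine and sine and survives products because the square of that element is congruent to
  a constant.\<close>

lemma lin_factor_remainder:
  assumes "w \<noteq> 0"
  shows "\<exists>h a b. f = lin_factor w * h + a *\<^sub>R 1 + b *\<^sub>R (Im w *\<^sub>R tp_cos - Re w *\<^sub>R tp_sin)"
proof -
  define q where "q = lin_factor w"
  define T where "T = Im w *\<^sub>R tp_cos - Re w *\<^sub>R tp_sin"
  define r where "r = (Re w)\<^sup>2 + (Im w)\<^sup>2"
  define e where "e = (1 + r) / 2"
  have r: "r \<noteq> 0" using assms by (simp add: r_def complex_eq_iff)
  have q: "tp_eval q t = 2 * e - 2 * Re w * cos t - 2 * Im w * sin t" for t
    by (simp add: q_def lin_factor_def e_def r_def cmod_power2)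
  have T: "tp_eval T t = Im w * cos t - Re w * sin t" for t
    by (simp add: T_def)
  \<comment> \<open>Put u = Re w cos t + Im w sin t. Then \<open>q\<close> = 2(e - u) and T^2 = r -
    u^2 = (e - u)(e + u) + (r - e^2).\<close>
  have TT: "T * T = q * (e *\<^sub>R 1 + (Re w) *\<^sub>R tp_cos + (Im w) *\<^sub>R tp_sin) * ((1/2) *\<^sub>R 1)
      + (r - e\<^sup>2) *\<^sub>R 1"
  proof (rule trig_poly_eqI)
    fix t :: real
    define c s where "c = cos t" and "s = sin t"
    have cs: "c\<^sup>2 + s\<^sup>2 = 1"
      unfolding c_def s_def by (rule sin_cos_squared_add2)
    have "(Im w * c - Re w * s)\<^sup>2 = r * (c\<^sup>2 + s\<^sup>2) - (Re w * c + Im w * s)\<^sup>2"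
      by (simp add: r_def power2_eq_square algebra_simps)
    then have "(Im w * c - Re w * s) * (Im w * c - Re w * s) = r - (Re w * c + Im w * s)\<^sup>2"
      unfolding cs by (simp add: power2_eq_square)
    then show "tp_eval (T * T) t = tp_eval (q * (e *\<^sub>R 1 + (Re w) *\<^sub>R tp_cos
        + (Im w) *\<^sub>R tp_sin) * ((1/2) *\<^sub>R 1) + (r - e\<^sup>2) *\<^sub>R 1) t"
      by (simp add: q T flip: c_def s_def) (simp add: power2_eq_square algebra_simps)
  qed
  have "\<exists>h a b. f = q * h + a *\<^sub>R 1 + b *\<^sub>R T"
  proof (induction f rule: trig_poly_induct)
    case (const c)
    have "c *\<^sub>R 1 = q * 0 + c *\<^sub>R 1 + 0 *\<^sub>R T" by simp
    then show ?case by blast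
  next
    case cos
    \<comment> \<open>Invert the linear map from (cos t, sin t) to (u, T), whose determinant is -r,
      and substitute u = e - q/2.\<close>
    have "tp_cos = q * ((- Re w / (2 * r)) *\<^sub>R 1) + (Re w * e / r) *\<^sub>R 1 + (Im w / r) *\<^sub>R T"
    proof (rule trig_poly_eqI)
      fix t
      have "cos t * r = Re w * (Re w * cos t + Im w * sin t) + Im w * (Im w * cos t - Re w * sin t)"
        by (simp add: r_def power2_eq_square algebra_simps)
      then have "tp_eval tp_cos t = (Re w * (Re w * cos t + Im w * sin t) + Im w * (Im w * cos t - Re w * sin t)) / r"
        using r by (simp add: nonzero_eq_divide_eq)
      also have "\<dots> = tp_eval (q * ((- Re w / (2 * r)) *\<^sub>R 1)
          + (Re w * e / r) *\<^sub>R 1 + (Im w / r) *\<^sub>R T) t"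
        using r by (simp add: q T field_simps)
      finally show "tp_eval tp_cos t = tp_eval (q * ((- Re w / (2 * r)) *\<^sub>R 1)
          + (Re w * e / r) *\<^sub>R 1 + (Im w / r) *\<^sub>R T) t" .
    qed
    then show ?case by blast
  next
    case sin
    have "tp_sin = q * ((- Im w / (2 * r)) *\<^sub>R 1) + (Im w * e / r) *\<^sub>R 1 + (- Re w / r) *\<^sub>R T"
    proof (rule trig_poly_eqI)
      fix t
      have "sin t * r = Im w * (Re w * cos t + Im w * sin t) - Re w * (Im w * cos t - Re w * sin t)"
        by (simp add: r_def power2_eq_square algebra_simps)
      then have "tp_eval tp_sin t = (Im w * (Re w * cos t + Im w * sin t) - Re w * (Im w * cos t - Re w * sin t)) / r"
        using r by (simp add: nonzero_eq_divide_eq)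
      also have "\<dots> = tp_eval (q * ((- Im w / (2 * r)) *\<^sub>R 1)
          + (Im w * e / r) *\<^sub>R 1 + (- Re w / r) *\<^sub>R T) t"
        using r by (simp add: q T field_simps)
      finally show "tp_eval tp_sin t = tp_eval (q * ((- Im w / (2 * r)) *\<^sub>R 1)
          + (Im w * e / r) *\<^sub>R 1 + (- Re w / r) *\<^sub>R T) t" .
    qed
    then show ?case by blast
  next
    case (add f g)
    then obtain h a b h' a' b' where
      "f = q * h + a *\<^sub>R 1 + b *\<^sub>R T" "g = q * h' + a' *\<^sub>R 1 + b' *\<^sub>R T" by blast
    then have "f + g = q * (h + h') + (a + a') *\<^sub>R 1 + (b + b') *\<^sub>R T"
      by (simp add: algebra_simps)
    then show ?case by blast
  next
    case (mult f g)
    then obtain h a b h' a' b' where fg: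
      "f = q * h + a *\<^sub>R 1 + b *\<^sub>R T" "g = q * h' + a' *\<^sub>R 1 + b' *\<^sub>R T" by blast
    obtain u d where u: "T * T = q * u + d *\<^sub>R 1"
      using TT by (metis mult.assoc)
    have "f * g = q * (h * g + (a *\<^sub>R 1 + b *\<^sub>R T) * h')
        + (a * a') *\<^sub>R 1 + (a * b' + a' * b) *\<^sub>R T + (b * b') *\<^sub>R (T * T)"
      by (rule trig_poly_eqI) (simp add: fg algebra_simps)
    also have "\<dots> = q * (h * g + (a *\<^sub>R 1 + b *\<^sub>R T) * h' + (b * b') *\<^sub>R u)
        + (a * a' + b * b' * d) *\<^sub>R 1 + (a * b' + a' * b) *\<^sub>R T"
      unfolding u by (rule trig_poly_eqI) (simp add: algebra_simps)
    finally show ?case by blast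
  qed
  then show ?thesis by (simp add: q_def T_def)
qed

text \<open>At \<open>w\<close> the remainder takes the value a - i b y with y = (1 - |w|^2)/2. Off
  the unit circle y is a non-zero real, so the vanishing of this value forces a = b = 0.\<close>

lemma lin_factor_dvd:
  assumes w: "w \<noteq> 0" "norm w \<noteq> 1" and f: "cev w f = 0"
  shows "lin_factor w dvd f"
proof -
  obtain h a b where h:
    "f = lin_factor w * h + a *\<^sub>R 1 + b *\<^sub>R (Im w *\<^sub>R tp_cos - Re w *\<^sub>R tp_sin)"
    using lin_factor_remainder[OF w(1)] by blast
  define y where "y = (1 - (norm w)\<^sup>2) / 2"
  have y: "y \<noteq> 0"
    using w(2) by (simp add: y_def power2_eq_1_iff) (use norm_ge_zero[of w] in linarith)
  have re: "of_real (Re w) = (w + cnj w) / 2" and im: "of_real (Im w) = (w - cnj w) / (2 * \<i>)"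
    by (simp_all add: complex_eq_iff)
  have nw: "of_real ((norm w)\<^sup>2) = w * cnj w"
    using complex_norm_square by simp
  have "cev w (Im w *\<^sub>R tp_cos - Re w *\<^sub>R tp_sin)
      = of_real (Im w) * ((w + 1 / w) / 2) - of_real (Re w) * (\<i> * (1 / w - w) / 2)"
    using w(1) by (simp add: cev_diff cev_scaleR cev_cos cev_sin)
  also have "\<dots> = - \<i> * of_real y"
    unfolding y_def re im using w(1)
    by (simp add: nw del: of_real_power) (simp add: field_simps)
  finally have "of_real a + of_real b * (- \<i> * of_real y) = 0"
    using f w(1) unfolding h by (simp add: cev_add cev_mult cev_scaleR cev_lin_factor cev_one)
  then have "a = 0" "b * y = 0"
    by (simp_all add: complex_eq_iff)
  then show ?thesis using h y by simp
qed

text \<open>The number of zeros in the punctured plane, with multiplicity.\<close>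

definition zero_count :: "trig_poly \<Rightarrow> nat" where
  "zero_count f = (SOME d. \<exists>p n. laurent_rep f p n \<and> d = degree p - order 0 p)"

lemma order_0_monom_1: "order 0 (monom (1::complex) n) = n"
  using order_power_n_n[of "0::complex" n] by (simp add: monom_altdef)

text \<open>A power of the variable raises the degree and the order at 0 by the same amount.\<close>

lemma zero_count_eq:
  assumes "laurent_rep f p n" "f \<noteq> 0"
  shows "zero_count f = degree p - order 0 p"
proof -
  have "\<exists>q m. laurent_rep f q m \<and> zero_count f = degree q - order 0 q"
    unfolding zero_count_def by (rule someI_ex) (use assms in blast)
  then obtain q m where q: "laurent_rep f q m" "zero_count f = degree q - order 0 q"
    by blast
  have nz: "p \<noteq> 0" "q \<noteq> 0" using assms q laurent_rep_eq_0_iff by metis+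
  have eq: "p * monom 1 m = q * monom 1 n"
    using laurent_rep_unique[OF assms(1) q(1)] .
  have "degree p + m = degree q + n"
    using arg_cong[OF eq, of degree] nz by (simp add: degree_mult_eq degree_monom_eq)
  moreover have "order 0 p + m = order 0 q + n"
    using arg_cong[OF eq, of "order 0"] nz by (simp add: order_mult order_0_monom_1)
  ultimately show ?thesis using q(2) by linarith
qed

text \<open>The numerator gains two zeros, neither at the origin. This strict growth provides the
  measure for the recursion in \<open>lin_factor_gcd\<close>.\<close>

lemma zero_count_lin_factor_mult:
  assumes "w \<noteq> 0" "f \<noteq> 0"
  shows "zero_count f < zero_count (lin_factor w * f)"
proof -
  obtain p n where p: "laurent_rep f p n" using laurent_rep_exists by metis
  define l where "l = [:-w, 1:] * [:1, - cnj w:]"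
  have l: "degree l = 2" "order 0 l = 0" "l \<noteq> 0"
    using assms(1) by (auto simp: l_def intro!: order_0I)
  have lf: "lin_factor w \<noteq> 0"
    using l(3) unfolding l_def laurent_rep_eq_0_iff[OF laurent_rep_lin_factor[of w]] .
  have "p \<noteq> 0" using laurent_rep_eq_0_iff[OF p] assms(2) by simp
  have rep: "laurent_rep (lin_factor w * f) (l * p) (1 + n)"
    unfolding l_def by (intro laurent_rep_mult laurent_rep_lin_factor p)
  have "zero_count (lin_factor w * f) = 2 + degree p - order 0 p"
    using zero_count_eq[OF rep] lf assms(2) l \<open>p \<noteq> 0\<close> by (simp add: degree_mult_eq order_mult)
  \<comment> \<open>The order at 0 is at most the degree, so the natural subtraction does not
    truncate.\<close>
  then show ?thesis
    using zero_count_eq[OF p assms(2)] order_degree[OF \<open>p \<noteq> 0\<close>, of 0] by linarith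
qed

section \<open>Greatest common divisors by splitting off common zeros\<close>

lemma lin_factor_gcd:
  assumes "\<And>t. tp_eval P t \<noteq> 0"
  shows "\<exists>G S R. P = G * S \<and> Q = G * R \<and> (\<forall>w. w \<noteq> 0 \<longrightarrow> cev w S = 0 \<longrightarrow> cev w R \<noteq> 0)"
  using assms
proof (induction "zero_count P" arbitrary: P Q rule: less_induct)
  case less
  show ?case
  proof (cases "\<exists>w. w \<noteq> 0 \<and> cev w P = 0 \<and> cev w Q = 0")
    case False
    then have "P = 1 * P \<and> Q = 1 * Q \<and> (\<forall>w. w \<noteq> 0 \<longrightarrow> cev w P = 0 \<longrightarrow> cev w Q \<noteq> 0)" by auto
    then show ?thesis by blast
  next
    case True
    then obtain w where w: "w \<noteq> 0" "cev w P = 0" "cev w Q = 0" by blast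
    \<comment> \<open>\<open>P\<close> has no real zero, so the common zero lies off the circle and
      \<open>lin_factor w\<close> splits off both elements; the zero count of \<open>P\<close>
      drops.\<close>
    have "norm w \<noteq> 1"
      using less.prems w(2) by (metis cev_unit_circle of_real_eq_0_iff)
    then obtain P' Q' where eq: "P = lin_factor w * P'" "Q = lin_factor w * Q'"
      using lin_factor_dvd[OF w(1)] w by (meson dvdE)
    have nz: "tp_eval P' t \<noteq> 0" for t using less.prems[of t] by (simp add: eq)
    then have "P' \<noteq> 0" by (metis tp_eval_simps(1))
    then obtain G S R where "P' = G * S" "Q' = G * R"
      "\<forall>w. w \<noteq> 0 \<longrightarrow> cev w S = 0 \<longrightarrow> cev w R \<noteq> 0"
      using less.hyps[of P' Q'] zero_count_lin_factor_mult[OF w(1), of P'] nz eq by metis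
    then have "P = (lin_factor w * G) * S \<and> Q = (lin_factor w * G) * R
        \<and> (\<forall>w. w \<noteq> 0 \<longrightarrow> cev w S = 0 \<longrightarrow> cev w R \<noteq> 0)"
      by (simp add: eq mult.assoc)
    then show ?thesis by blast
  qed
qed

section \<open>Derivatives\<close>

lemma deriv_trig_fun: "f \<in> trig_fun \<Longrightarrow> deriv f \<in> trig_fun"
proof (induction rule: trig_fun.induct)
  case (const c)
  have "deriv (\<lambda>_. c) = (\<lambda>_. 0::real)" by (simp add: fun_eq_iff)
  then show ?case by (simp add: trig_fun.const)
next
  case cos
  have "deriv cos = (\<lambda>t. - sin (t::real))"
    by (intro ext DERIV_imp_deriv DERIV_cos)
  then show ?case by (simp add: trig_fun_uminus trig_fun.sin)
next
  case sin
  have "deriv sin = (cos :: real \<Rightarrow> real)"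
    by (intro ext DERIV_imp_deriv DERIV_sin)
  then show ?case by (simp add: trig_fun.cos)
next
  case (add f g)
  have "f field_differentiable at t" "g field_differentiable at t" for t
    using tp_eval_differentiable[of "Abs_trig_poly f"] tp_eval_differentiable[of "Abs_trig_poly g"] add
    by (simp_all add: Abs_trig_poly_inverse)
  then have "deriv (\<lambda>t. f t + g t) = (\<lambda>t. deriv f t + deriv g t)"
    by (intro ext deriv_add) auto
  then show ?case using add by (simp add: trig_fun.add)
next
  case (mult f g)
  have "f field_differentiable at t" "g field_differentiable at t" for t
    using tp_eval_differentiable[of "Abs_trig_poly f"] tp_eval_differentiable[of "Abs_trig_poly g"] mult
    by (simp_all add: Abs_trig_poly_inverse)
  then have "deriv (\<lambda>t. f t * g t) = (\<lambda>t. f t * deriv g t + deriv f t * g t)"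
    by (intro ext deriv_mult) auto
  then show ?case using mult by (simp add: trig_fun.add trig_fun.mult)
qed

lift_definition tp_deriv :: "trig_poly \<Rightarrow> trig_poly" is deriv
  by (rule deriv_trig_fun)

lemma deriv_tp_eval: "deriv (tp_eval f) t = tp_eval (tp_deriv f) t"
  by transfer simp

lemma tp_eval_has_deriv: "(tp_eval f has_real_derivative tp_eval (tp_deriv f) t) (at t)"
  using tp_eval_differentiable[of f t] by (metis DERIV_deriv_iff_field_differentiable deriv_tp_eval)

lemma tp_derivI:
  assumes "\<And>t. (tp_eval f has_real_derivative tp_eval g t) (at t)"
  shows "tp_deriv f = g"
  using assms by (intro trig_poly_eqI) (metis DERIV_unique tp_eval_has_deriv)

lemma tp_deriv_mult: "tp_deriv (f * g) = f * tp_deriv g + tp_deriv f * g"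
proof (rule tp_derivI)
  fix t
  have "((\<lambda>t. tp_eval f t * tp_eval g t) has_real_derivative
      tp_eval f t * tp_eval (tp_deriv g) t + tp_eval (tp_deriv f) t * tp_eval g t) (at t)"
    by (rule DERIV_mult' tp_eval_has_deriv)+
  moreover have "tp_eval (f * g) = (\<lambda>t. tp_eval f t * tp_eval g t)" by (simp add: fun_eq_iff)
  ultimately show "(tp_eval (f * g) has_real_derivative
      tp_eval (f * tp_deriv g + tp_deriv f * g) t) (at t)" by simp
qed

lemma tp_deriv_add: "tp_deriv (f + g) = tp_deriv f + tp_deriv g"
proof (rule tp_derivI)
  fix t
  have "((\<lambda>t. tp_eval f t + tp_eval g t) has_real_derivative
      tp_eval (tp_deriv f) t + tp_eval (tp_deriv g) t) (at t)"
    by (rule DERIV_add tp_eval_has_deriv)+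
  moreover have "tp_eval (f + g) = (\<lambda>t. tp_eval f t + tp_eval g t)" by (simp add: fun_eq_iff)
  ultimately show "(tp_eval (f + g) has_real_derivative
      tp_eval (tp_deriv f + tp_deriv g) t) (at t)" by simp
qed

lemma tp_deriv_const [simp]: "tp_deriv (c *\<^sub>R 1) = 0"
proof (rule tp_derivI)
  have "tp_eval (c *\<^sub>R 1) = (\<lambda>_. c)" by (simp add: fun_eq_iff)
  then show "(tp_eval (c *\<^sub>R 1) has_real_derivative tp_eval 0 t) (at t)" for t
    by simp
qed

lemma tp_deriv_one [simp]: "tp_deriv 1 = 0"
  using tp_deriv_const[of 1] by simp

lemma tp_deriv_scaleR: "tp_deriv (c *\<^sub>R f) = c *\<^sub>R tp_deriv f"
  using tp_deriv_mult[of "c *\<^sub>R 1" f] by simp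

text \<open>Differentiate f z^n = p(z) along z = \<open>cis t\<close>, where dz/dt = i z: this gives
  f' z^n = i (z p'(z) - n p(z)).\<close>

lemma laurent_rep_deriv:
  assumes "laurent_rep f p n"
  shows "laurent_rep (tp_deriv f) (smult \<i> (pCons 0 (pderiv p) - smult (of_nat n) p)) n"
  unfolding laurent_rep_def
proof
  fix t
  define F where "F = (\<lambda>t. of_real (tp_eval f t) :: complex)"
  have cis: "(cis has_vector_derivative \<i> * cis t) (at t)"
    unfolding cis_conv_exp
    by (rule derivative_eq_intros has_vector_derivative_real_field | simp)+
  have F: "(F has_vector_derivative of_real (tp_eval (tp_deriv f) t)) (at t)"
    unfolding F_def using tp_eval_has_deriv[of f t]
    by (intro has_vector_derivative_of_real)
      (simp add: has_real_derivative_iff_has_vector_derivative)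
  have pw: "((\<lambda>t. cis t ^ n) has_vector_derivative (\<i> * cis t) * (of_nat n * cis t ^ (n - 1))) (at t)"
  proof -
    have "((\<lambda>z. z ^ n) has_field_derivative of_nat n * cis t ^ (n - 1)) (at (cis t))"
      by (auto intro!: derivative_eq_intros)
    from field_vector_diff_chain_at[OF cis this] show ?thesis by (simp add: o_def)
  qed
  have "((\<lambda>t. F t * cis t ^ n) has_vector_derivative
      F t * ((\<i> * cis t) * (of_nat n * cis t ^ (n - 1)))
      + of_real (tp_eval (tp_deriv f) t) * cis t ^ n) (at t)"
    by (rule has_vector_derivative_mult F pw)+
  moreover have "(\<lambda>t. F t * cis t ^ n) = (\<lambda>t. poly p (cis t))"
    using assms by (simp add: laurent_rep_def F_def)
  moreover have "((\<lambda>t. poly p (cis t)) has_vector_derivative (\<i> * cis t) * poly (pderiv p) (cis t)) (at t)"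
    using field_vector_diff_chain_at[OF cis poly_DERIV, of p] by (simp add: o_def)
  ultimately have eq: "F t * ((\<i> * cis t) * (of_nat n * cis t ^ (n - 1)))
      + of_real (tp_eval (tp_deriv f) t) * cis t ^ n = (\<i> * cis t) * poly (pderiv p) (cis t)"
    using vector_derivative_unique_at by metis
  \<comment> \<open>The case n = 0 is separate because \<open>n - 1\<close> truncates there.\<close>
  have "F t * ((\<i> * cis t) * (of_nat n * cis t ^ (n - 1))) = \<i> * of_nat n * (F t * cis t ^ n)"
    by (cases n) (simp_all add: algebra_simps)
  also have "F t * cis t ^ n = poly p (cis t)"
    using assms by (simp add: laurent_rep_def F_def)
  finally have "F t * ((\<i> * cis t) * (of_nat n * cis t ^ (n - 1))) = \<i> * of_nat n * poly p (cis t)" .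
  with eq have "\<i> * of_nat n * poly p (cis t) + of_real (tp_eval (tp_deriv f) t) * cis t ^ n
      = (\<i> * cis t) * poly (pderiv p) (cis t)"
    by (simp only:)
  then show "of_real (tp_eval (tp_deriv f) t) * cis t ^ n =
      poly (smult \<i> (pCons 0 (pderiv p) - smult (of_nat n) p)) (cis t)"
    by (simp add: algebra_simps)
qed

section \<open>Poles of logarithmic derivatives\<close>

lemma poly_log_deriv_zero:
  fixes p u v :: "complex poly"
  assumes "p * u = v * pderiv p" "p \<noteq> 0" "poly p w = 0"
  shows "poly v w = 0"
proof (rule ccontr)
  assume v: "poly v w \<noteq> 0"
  have "pderiv p \<noteq> 0"
  proof
    assume "pderiv p = 0"
    then obtain c where "p = [:c:]"
      by (metis degree_eq_zeroE pderiv_eq_0_iff)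
    then show False using assms by simp
  qed
  then have vp: "v * pderiv p \<noteq> 0" using v by auto
  then have u: "u \<noteq> 0" using assms(1) by auto
  \<comment> \<open>Differentiation lowers the order at the zero \<open>w\<close> by one, so the
    right side would vanish to lower order than the left.\<close>
  have "order w (v * pderiv p) = order w (pderiv p)"
    using order_mult[OF vp, of w] order_0I[OF v] by simp
  moreover have "order w (p * u) = order w p + order w u"
    using assms(2) u by (intro order_mult) simp
  ultimately show False
    using assms(1) order_pderiv[OF assms(2,3)] by simp
qed

text \<open>The logarithmic derivative of \<open>H\<close> has a pole at every zero of \<open>H\<close>.\<close>

lemma cev_log_deriv_zero:
  assumes eq: "H * T = V * tp_deriv H" and H: "H \<noteq> 0" and w: "w \<noteq> 0" "cev w H = 0"
  shows "cev w V = 0"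
proof -
  obtain p n where p: "laurent_rep H p n" using laurent_rep_exists by metis
  obtain q m where q: "laurent_rep T q m" using laurent_rep_exists by metis
  obtain v l where v: "laurent_rep V v l" using laurent_rep_exists by metis
  define d where "d = smult \<i> (pCons 0 (pderiv p) - smult (of_nat n) p)"
  have "p * q * monom 1 (l + n) = v * d * monom 1 (n + m)"
    using laurent_rep_unique[OF laurent_rep_mult[OF p q]]
      laurent_rep_mult[OF v laurent_rep_deriv[OF p]]
    unfolding eq d_def .
  moreover have "d = monom \<i> 1 * pderiv p - smult (\<i> * of_nat n) p"
    by (simp add: d_def monom_altdef smult_diff_right)
  \<comment> \<open>The part of \<open>d\<close> proportional to \<open>p\<close> moves to the left,
    which leaves the shape of \<open>poly_log_deriv_zero\<close>; the added monomials do not vanish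
    at \<open>w\<close>.\<close>
  ultimately have "p * (q * monom 1 (l + n) + smult (\<i> * of_nat n) (v * monom 1 (n + m)))
      = (v * monom \<i> 1 * monom 1 (n + m)) * pderiv p"
    by (simp add: algebra_simps)
  then have "poly (v * monom \<i> 1 * monom 1 (n + m)) w = 0"
    by (rule poly_log_deriv_zero) (use H w p laurent_rep_eq_0_iff cev_eq_0_iff in blast)+
  then have "poly v w = 0" using w(1) by (simp add: poly_monom)
  then show ?thesis using cev_eq_0_iff[OF w(1) v] by simp
qed

section \<open>Invariant curves\<close>

lemma abel_field_line_fun:
  "abel_field A B (line_fun P Q) t x = tp_eval (tp_deriv Q) t - tp_eval (tp_deriv P) t * x
    - (tp_eval A t * x ^ 3 + tp_eval B t * x ^ 2) * tp_eval P t"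
proof -
  have "((\<lambda>s. line_fun P Q s x) has_real_derivative
      tp_eval (tp_deriv Q) t - tp_eval (tp_deriv P) t * x) (at t)"
    unfolding line_fun_def
    by (rule DERIV_diff DERIV_cmult_right tp_eval_has_deriv)+
  moreover have "((\<lambda>y. line_fun P Q t y) has_real_derivative - tp_eval P t) (at x)"
    unfolding line_fun_def by (auto intro!: derivative_eq_intros)
  ultimately show ?thesis
    unfolding abel_field_def by (simp add: DERIV_imp_deriv)
qed

text \<open>At x = Q/P the term K f vanishes whatever \<open>K\<close> is; multiplying by P^2 clears
  the denominators.\<close>

lemma invariant_curve_eq:
  assumes "invariant_curve A B P Q"
  shows "P * (P * tp_deriv Q - tp_deriv P * Q) = Q * Q * (A * Q + B * P)"
proof (rule trig_poly_eqI)
  fix t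
  define x where "x = tp_eval Q t / tp_eval P t"
  have P: "tp_eval P t \<noteq> 0" using assms by (simp add: invariant_curve_def)
  then have x: "tp_eval Q t = tp_eval P t * x" by (simp add: x_def)
  then have "line_fun P Q t x = 0" by (simp add: line_fun_def)
  then have "abel_field A B (line_fun P Q) t x = 0"
    using assms by (auto simp: invariant_curve_def)
  then have e: "tp_eval (tp_deriv Q) t = tp_eval (tp_deriv P) t * x
      + (tp_eval A t * x ^ 3 + tp_eval B t * x ^ 2) * tp_eval P t"
    by (simp add: abel_field_line_fun)
  show "tp_eval (P * (P * tp_deriv Q - tp_deriv P * Q)) t = tp_eval (Q * Q * (A * Q + B * P)) t"
    by (simp add: e x algebra_simps power2_eq_square power3_eq_cube)
qed

lemma tp_eval_nonzero_imp: "(\<And>t. tp_eval P t \<noteq> 0) \<Longrightarrow> P \<noteq> 0"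
  by (metis tp_eval_simps(1))

lemma invariant_curve_const:
  assumes inv: "invariant_curve A B P Q" and Q: "Q \<noteq> 0"
  obtains c where "c \<noteq> 0" "Q = c *\<^sub>R 1"
proof (rule const_if_cev_nonzero)
  fix w :: complex
  assume w: "w \<noteq> 0"
  have P: "\<And>t. tp_eval P t \<noteq> 0" and irr: "irreducible [:Q, - P:]"
    using inv by (auto simp: invariant_curve_def)
  show "cev w Q \<noteq> 0"
  proof
    assume Qw: "cev w Q = 0"
    \<comment> \<open>In this form \<open>Q\<close> divides P^2 Q', so a zero of \<open>Q\<close>
      must be a zero of P^2.\<close>
    have "Q * (Q * (A * Q + B * P) + P * tp_deriv P) = (P * P) * tp_deriv Q"
      using invariant_curve_eq[OF inv] by (simp add: algebra_simps)
    then have "cev w (P * P) = 0"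
      using cev_log_deriv_zero Q w Qw by blast
    then have Pw: "cev w P = 0" by (simp add: cev_mult w)
    then have nw: "norm w \<noteq> 1"
      using P by (metis cev_unit_circle of_real_eq_0_iff)
    obtain P' Q' where eq: "P = lin_factor w * P'" "Q = lin_factor w * Q'"
      using lin_factor_dvd[OF w nw] Pw Qw by (meson dvdE)
    \<comment> \<open>A common zero off the circle gives a factorisation in which neither factor is
      a unit.\<close>
    then have "[:Q, - P:] = [:lin_factor w:] * [:Q', - P':]" by simp
    then have "[:lin_factor w:] dvd 1 \<or> [:Q', - P':] dvd 1"
      using irr by (blast dest: irreducibleD)
    moreover have "P' \<noteq> 0" using tp_eval_nonzero_imp[OF P] eq by auto
    then have "\<not> [:Q', - P':] dvd 1"
      by (auto simp: is_unit_poly_iff)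
    ultimately have "lin_factor w dvd 1"
      using is_unit_const_poly_iff by blast
    then show False
      using not_unit_if_cev_0[OF w cev_lin_factor[OF w]] by blast
  qed
qed (use that in blast)

lemma invariant_curveI:
  assumes P: "\<And>t. tp_eval P t \<noteq> 0" and eq: "A + B * P + P * tp_deriv P = 0"
  shows "invariant_curve A B P 1"
  unfolding invariant_curve_def
proof (intro conjI allI)
  have P0: "P \<noteq> 0" using tp_eval_nonzero_imp[OF P] .
  have deg: "degree [:1, - P:] = 1" using P0 by simp
  show "irreducible [:1, - P:]"
  proof (rule irreducibleI)
    show "\<not> [:1, - P:] dvd 1" using P0 by (auto simp: is_unit_poly_iff)
    fix a b assume ab: "[:1, - P:] = a * b"
    then have nz: "a \<noteq> 0" "b \<noteq> 0" using P0 by auto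
    have "degree a + degree b = 1" using deg ab degree_mult_eq[OF nz] by simp
    then have "degree a = 0 \<or> degree b = 0" by arith
    \<comment> \<open>A factor of degree 0 divides every coefficient, in particular the constant
      coefficient 1.\<close>
    moreover have "c dvd 1" if c: "degree c = 0" "c dvd [:1, - P:]" for c
    proof -
      obtain k where k: "c = [:k:]" using c(1) degree_eq_zeroE by blast
      with c(2) have "k dvd 1" by (simp add: const_poly_dvd_iff) (metis coeff_pCons_0)
      then show ?thesis using k is_unit_const_poly_iff by blast
    qed
    ultimately show "a dvd 1 \<or> b dvd 1" using ab by (metis dvd_triv_left dvd_triv_right)
  qed (use P0 in simp)
  \<comment> \<open>The quotient by 1 - P x: the equation gives A = -P (P' + B), which makes the
    division exact.\<close>
  define K where "K = (\<lambda>(t, x). - tp_eval (tp_deriv P) t * x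
      - tp_eval P t * (tp_eval (tp_deriv P) t + tp_eval B t) * x ^ 2)"
  have cont: "continuous_on UNIV (\<lambda>z :: real \<times> real. tp_eval f (fst z))" for f
  proof -
    have "continuous_on UNIV (tp_eval f)"
      using tp_eval_has_deriv DERIV_continuous_on by (metis has_field_derivative_at_within)
    then show ?thesis
      by (rule continuous_on_compose2) (auto intro: continuous_intros)
  qed
  have "continuous_on UNIV K"
    unfolding K_def case_prod_unfold by (intro continuous_intros cont)
  moreover have "abel_field A B (line_fun P 1) t x = K (t, x) * line_fun P 1 t x" for t x
  proof -
    have "tp_eval (A + B * P + P * tp_deriv P) t = 0" unfolding eq by simp
    then have A: "tp_eval A t = - tp_eval P t * (tp_eval (tp_deriv P) t + tp_eval B t)"
      by (simp add: algebra_simps)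
    show ?thesis
      by (simp add: A abel_field_line_fun K_def line_fun_def algebra_simps power2_eq_square
          power3_eq_cube)
  qed
  ultimately show "\<exists>K. continuous_on UNIV K \<and> (\<forall>t x.
      abel_field A B (line_fun P 1) t x = K (t, x) * line_fun P 1 t x)" by blast
qed (use P in simp)

lemma curve_eq_iff:
  assumes "\<And>t. tp_eval P t \<noteq> 0"
  shows "curve P 1 = curve R 1 \<longleftrightarrow> P = R"
proof
  assume eq: "curve P 1 = curve R 1"
  show "P = R"
  proof (rule trig_poly_eqI)
    fix t
    have "(t, 1 / tp_eval P t) \<in> curve P 1"
      using assms by (simp add: curve_def line_fun_def)
    then have "(t, 1 / tp_eval P t) \<in> curve R 1" using eq by simp
    then show "tp_eval P t = tp_eval R t"
      using assms[of t] by (simp add: curve_def line_fun_def)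
  qed
qed simp

lemma invariant_curve_normalize:
  assumes inv: "invariant_curve A B P Q" and "Q \<noteq> 0"
  obtains R where "curve P Q = curve R 1" "\<And>t. tp_eval R t \<noteq> 0" "A + B * R + R * tp_deriv R = 0"
proof -
  obtain c where c: "c \<noteq> 0" "Q = c *\<^sub>R 1" using invariant_curve_const[OF assms] .
  define R where "R = (1 / c) *\<^sub>R P"
  have P: "P = c *\<^sub>R R" using c by (simp add: R_def)
  \<comment> \<open>With Q = c and P = c R, both sides of \<open>invariant_curve_eq\<close> carry
    the factor c^3.\<close>
  have "c *\<^sub>R c *\<^sub>R c *\<^sub>R (A + B * R + R * tp_deriv R) = 0"
    using invariant_curve_eq[OF inv] by (simp add: c P tp_deriv_scaleR algebra_simps)
      (metis ab_left_minus add.assoc add.commute)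
  then have "A + B * R + R * tp_deriv R = 0" using c(1) by simp
  moreover have "curve P Q = curve R 1"
    using c(1) by (auto simp: curve_def line_fun_def P c(2))
  moreover have "tp_eval R t \<noteq> 0" for t
    using inv c(1) by (simp add: R_def invariant_curve_def)
  ultimately show ?thesis using that by blast
qed

section \<open>The two directions of the equivalence\<close>

lemma curve_data_imp_curves:
  assumes data: "curve_data A B G Gh S1 k"
  shows "two_different_nontrivial_curves A B (G * S1) 1 (G * (S1 + k *\<^sub>R Gh)) 1"
proof -
  define S2 where "S2 = S1 + k *\<^sub>R Gh"
  define R where "R t = tp_eval (tp_deriv G) t
    + tp_eval G t * tp_eval (tp_deriv Gh) t / tp_eval Gh t" for t
  have nz: "Gh \<noteq> 0" "k \<noteq> 0" "\<And>t. tp_eval G t \<noteq> 0" "\<And>t. tp_eval S1 t \<noteq> 0" "\<And>t. tp_eval S2 t \<noteq> 0"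
    using data by (auto simp: curve_data_def S2_def)
  have A: "tp_eval A t = tp_eval G t * tp_eval S1 t * tp_eval S2 t * R t" for t
    using data by (simp add: curve_data_def S2_def R_def deriv_tp_eval)
  have fun_mult: "(\<lambda>s. tp_eval G s * tp_eval S1 s) = tp_eval (G * S1)"
    by (simp add: fun_eq_iff)
  have B: "tp_eval B t = - tp_eval (tp_deriv (G * S1)) t - tp_eval S2 t * R t" for t
    using data unfolding curve_data_def fun_mult deriv_tp_eval by (simp add: S2_def R_def)
  \<comment> \<open>Here A = (G S1) S2 R and B + (G S1)' = -S2 R, so the terms cancel.\<close>
  have "A + B * (G * S1) + (G * S1) * tp_deriv (G * S1) = 0"
    by (rule trig_poly_eqI) (simp add: A B algebra_simps)
  then have inv1: "invariant_curve A B (G * S1) 1"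
    using nz by (intro invariant_curveI) auto
  define E where "E = A + B * (G * S2) + (G * S2) * tp_deriv (G * S2)"
  \<comment> \<open>Multiplying by \<open>Gh\<close> avoids discussing the zeros of \<open>Gh\<close>, where \<open>R\<close> takes a junk value.\<close>
  have "Gh * E = 0"
  proof (rule trig_poly_eqI)
    fix t
    show "tp_eval (Gh * E) t = tp_eval 0 t"
    proof (cases "tp_eval Gh t = 0")
      case False
      have d: "tp_deriv (G * S2) = tp_deriv (G * S1) + k *\<^sub>R (G * tp_deriv Gh + tp_deriv G * Gh)"
        by (simp add: S2_def tp_deriv_mult tp_deriv_add tp_deriv_scaleR algebra_simps)
      \<comment> \<open>\<open>R\<close> is (G Gh)'/Gh, and k (G Gh)' is the difference of the
        derivatives of G S2 and G S1. Hence \<open>E\<close> is G S2 R (S1 - S2 + k Gh), which is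
        zero.\<close>
      have R: "R t * tp_eval Gh t = tp_eval (G * tp_deriv Gh + tp_deriv G * Gh) t"
        using False by (simp add: R_def field_simps)
      have "tp_eval E t = tp_eval G t * tp_eval S2 t
        * (R t * tp_eval S1 t - R t * tp_eval S2 t + k * (R t * tp_eval Gh t))"
        unfolding R by (simp add: E_def A B d algebra_simps)
      also have "\<dots> = 0" by (simp add: S2_def algebra_simps)
      finally show ?thesis by simp
    qed simp
  qed
  then have "E = 0" using nz by simp
  then have inv2: "invariant_curve A B (G * S2) 1"
    using nz by (intro invariant_curveI) (auto simp: E_def)
  have "G \<noteq> 0" using tp_eval_nonzero_imp nz by blast
  then have "G * S1 \<noteq> G * S2" using nz by (simp add: S2_def)
  then have "curve (G * S1) 1 \<noteq> curve (G * S2) 1"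
    using curve_eq_iff[of "G * S1"] nz by simp
  with inv1 inv2 show ?thesis
    by (simp add: two_different_nontrivial_curves_def flip: S2_def)
qed

lemma curves_imp_curve_data:
  assumes curves: "two_different_nontrivial_curves A B P1 Q1 P2 Q2"
  shows "\<exists>G Gh S1 k. curve_data A B G Gh S1 k
    \<and> curve P1 Q1 = curve (G * S1) 1 \<and> curve P2 Q2 = curve (G * (S1 + k *\<^sub>R Gh)) 1"
proof -
  obtain R1 where R1: "curve P1 Q1 = curve R1 1" "\<And>t. tp_eval R1 t \<noteq> 0"
      "A + B * R1 + R1 * tp_deriv R1 = 0"
    using curves invariant_curve_normalize unfolding two_different_nontrivial_curves_def by metis
  obtain R2 where R2: "curve P2 Q2 = curve R2 1" "\<And>t. tp_eval R2 t \<noteq> 0"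
      "A + B * R2 + R2 * tp_deriv R2 = 0"
    using curves invariant_curve_normalize unfolding two_different_nontrivial_curves_def by metis
  obtain G S1 S2 where G: "R1 = G * S1" "R2 = G * S2"
    and cop: "\<And>w. w \<noteq> 0 \<Longrightarrow> cev w S1 = 0 \<Longrightarrow> cev w S2 \<noteq> 0"
    using lin_factor_gcd[OF R1(2), of R2] by blast
  define Gh where "Gh = S2 - S1"
  have S2: "S2 = S1 + Gh" by (simp add: Gh_def)
  have nz: "tp_eval G t \<noteq> 0" "tp_eval S1 t \<noteq> 0" "tp_eval S2 t \<noteq> 0" for t
    using R1(2)[of t] R2(2)[of t] by (auto simp: G)
  have "R1 \<noteq> R2"
    using curves R1(1) R2(1) by (auto simp: two_different_nontrivial_curves_def)
  then have Gh: "Gh \<noteq> 0" by (auto simp: Gh_def G)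
  have G0: "G \<noteq> 0" using tp_eval_nonzero_imp nz by blast
  \<comment> \<open>Subtracting the two curve equations eliminates \<open>A\<close>, and every
    remaining term contains \<open>G\<close>.\<close>
  have "G * (Gh * (- B - tp_deriv R1 - S2 * tp_deriv G) - S2 * G * tp_deriv Gh)
      = (A + B * R1 + R1 * tp_deriv R1) - (A + B * R2 + R2 * tp_deriv R2)"
    by (simp add: G S2 tp_deriv_mult tp_deriv_add algebra_simps)
  then have quot: "Gh * (- B - tp_deriv R1 - S2 * tp_deriv G) = (S2 * G) * tp_deriv Gh"
    using G0 R1(3) R2(3) by simp
  \<comment> \<open>At a zero of \<open>Gh\<close> the values of \<open>S1\<close> and
    \<open>S2\<close> agree, so \<open>S2\<close> cannot vanish there; the pole argument leaves only
    \<open>G\<close>.\<close>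
  have zero: "cev w G = 0" if w: "w \<noteq> 0" "cev w Gh = 0" for w
  proof -
    have "cev w (S2 * G) = 0" using cev_log_deriv_zero[OF quot Gh w] .
    moreover have "cev w S2 \<noteq> 0"
      using cop[OF w(1)] w by (auto simp: S2 cev_add)
    ultimately show ?thesis using w(1) by (simp add: cev_mult)
  qed
  have Gh_nz: "tp_eval Gh t \<noteq> 0" for t
    using zero[of "cis t"] nz(1)[of t] by (auto simp: cev_cis)
  \<comment> \<open>A non-unit has a zero \<open>w\<close>, which passes to \<open>Gh\<close> and
    then to \<open>G\<close> and so lies off the circle. Irreducibility makes \<open>q\<close> an
    associate of \<open>lin_factor w\<close>, which divides \<open>G\<close>.\<close>
  have dvd: "q dvd G" if q: "irreducible q" "q dvd Gh" for q
  proof -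
    have "\<exists>w. w \<noteq> 0 \<and> cev w q = 0"
    proof (rule ccontr)
      assume "\<nexists>w. w \<noteq> 0 \<and> cev w q = 0"
      then obtain c where "c \<noteq> 0" "q = c *\<^sub>R 1" using const_if_cev_nonzero by metis
      then have "1 = q * ((1 / c) *\<^sub>R 1)" by simp
      then show False using q(1) irreducible_not_unit dvdI by blast
    qed
    then obtain w where w: "w \<noteq> 0" "cev w q = 0" by blast
    have Gw: "cev w G = 0" using zero[OF w(1)] cev_dvd_0[OF w(1) q(2) w(2)] by blast
    then have nw: "norm w \<noteq> 1" using nz(1) by (metis cev_unit_circle of_real_eq_0_iff)
    obtain c where c: "q = lin_factor w * c" using lin_factor_dvd[OF w(1) nw w(2)] by (rule dvdE)
    then have "c dvd 1"
      using irreducibleD[OF q(1) c] not_unit_if_cev_0[OF w(1) cev_lin_factor[OF w(1)]] by blast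
    then have "q dvd lin_factor w" using c by (simp add: mult_unit_dvd_iff)
    then show ?thesis using lin_factor_dvd[OF w(1) nw Gw] dvd_trans by blast
  qed
  have fun_mult: "(\<lambda>s. tp_eval G s * tp_eval S1 s) = tp_eval R1"
    by (simp add: fun_eq_iff G)
  \<comment> \<open>Divide \<open>quot\<close> by \<open>Gh\<close>, which has no real zeros;
    \<open>A\<close> then follows from the equation of the first curve.\<close>
  have B: "tp_eval B t = - tp_eval (tp_deriv R1) t - tp_eval S2 t
      * (tp_eval (tp_deriv G) t + tp_eval G t * tp_eval (tp_deriv Gh) t / tp_eval Gh t)" for t
  proof -
    have "tp_eval Gh t * (- tp_eval B t - tp_eval (tp_deriv R1) t
        - tp_eval S2 t * tp_eval (tp_deriv G) t) = tp_eval S2 t * tp_eval G t * tp_eval (tp_deriv Gh) t"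
      using arg_cong[OF quot, of "\<lambda>f. tp_eval f t"] by simp
    then have "- tp_eval B t - tp_eval (tp_deriv R1) t - tp_eval S2 t * tp_eval (tp_deriv G) t
        = tp_eval S2 t * (tp_eval G t * tp_eval (tp_deriv Gh) t / tp_eval Gh t)"
      using Gh_nz[of t] by (simp add: nonzero_eq_divide_eq mult_ac)
    then show ?thesis by (simp add: distrib_left)
  qed
  have A: "tp_eval A t = tp_eval G t * tp_eval S1 t * tp_eval S2 t
      * (tp_eval (tp_deriv G) t + tp_eval G t * tp_eval (tp_deriv Gh) t / tp_eval Gh t)" for t
  proof -
    have "tp_eval (A + B * R1 + R1 * tp_deriv R1) t = 0" by (simp only: R1(3) tp_eval_simps)
    then have "tp_eval A t = tp_eval R1 t * (- tp_eval B t - tp_eval (tp_deriv R1) t)"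
      by (simp add: algebra_simps)
    then show ?thesis unfolding B by (simp add: G)
  qed
  have ev_S2: "tp_eval S1 t + 1 * tp_eval Gh t = tp_eval S2 t" for t by (simp add: S2)
  \<comment> \<open>Since \<open>Gh\<close> is the full difference of \<open>S2\<close> and
    \<open>S1\<close>, the constant k is 1.\<close>
  have "curve_data A B G Gh S1 1"
    unfolding curve_data_def ev_S2 fun_mult deriv_tp_eval using Gh nz dvd A B by simp
  moreover have "R2 = G * (S1 + 1 *\<^sub>R Gh)" by (simp add: G S2)
  ultimately show ?thesis using R1(1) R2(1) G(1) by metis
qed

theorem proposition2p10:
  fixes A B :: trig_poly
  shows "((\<exists>P1 Q1 P2 Q2. two_different_nontrivial_curves A B P1 Q1 P2 Q2)
            \<longleftrightarrow> (\<exists>G Gh S1 k. curve_data A B G Gh S1 k))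
       \<and> (\<forall>G Gh S1 k. curve_data A B G Gh S1 k \<longrightarrow>
            two_different_nontrivial_curves A B (G * S1) 1 (G * (S1 + k *\<^sub>R Gh)) 1)
       \<and> (\<forall>P1 Q1 P2 Q2. two_different_nontrivial_curves A B P1 Q1 P2 Q2 \<longrightarrow>
            (\<exists>G Gh S1 k. curve_data A B G Gh S1 k
               \<and> curve P1 Q1 = curve (G * S1) 1
               \<and> curve P2 Q2 = curve (G * (S1 + k *\<^sub>R Gh)) 1))"
  using curve_data_imp_curves curves_imp_curve_data by metis

end
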